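(* The set of all 2-dimensional endo-commutative straight algebras of type I over the rational number field $\mathbb Q$ is countably infinite up to isomorphism; that is, the set of isomorphism classes of such algebras is countably infinite.
   Context: An algebra over a field $K$ is a $K$-vector space with a $K$-bilinear multiplication, not assumed associative, commutative or unital; isomorphism means bijective $K$-linear multiplicative map. An algebra $A$ is endo-commutative if $x^2y^2=(xy)^2$ for all $x,y\in A$. A 2-dimensional algebra is curled if $x^2$ is a scalar multiple of $x$ for every element $x$; otherwise it is straight. For $(p,q,a,b,c,d)\in K^6$, $S(p,q,a,b,c,d)$ denotes the (straight) algebra over $K$ with linear base $\{e,f\}$ and multiplication $e^2=f$, $ef=ae+bf$, $fe=ce+df$, $f^2=pe+qf$. An endo-commutative straight algebra of type I over $K$ is an endo-commutative algebra of the form $S(p,q,a,b,c,d)$ for which exactly one of $p,a,c$ is nonzero. Here $K=\mathbb Q$. *)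

theory Defs
  imports "HOL-Analysis.Analysis"
begin

text \<open>A 2-dimensional algebra over \<open>K\<close> is a \<open>K\<close>-bilinear product on the vector space
  \<open>K\<^sup>2\<close>; up to isomorphism, fixing the underlying space is no restriction.\<close>

definition algebra_product :: "('k::field^2 \<Rightarrow> 'k^2 \<Rightarrow> 'k^2) \<Rightarrow> bool" where
  "algebra_product m \<longleftrightarrow>
     (\<forall>x. Vector_Spaces.linear (*s) (*s) (\<lambda>y. m x y)) \<and>
     (\<forall>y. Vector_Spaces.linear (*s) (*s) (\<lambda>x. m x y))"

definition algebra_isomorphic ::
    "('k::field^2 \<Rightarrow> 'k^2 \<Rightarrow> 'k^2) \<Rightarrow> ('k^2 \<Rightarrow> 'k^2 \<Rightarrow> 'k^2) \<Rightarrow> bool" where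
  "algebra_isomorphic m m' \<longleftrightarrow>
     (\<exists>\<phi>. Vector_Spaces.linear (*s) (*s) \<phi> \<and> bij \<phi> \<and> (\<forall>x y. \<phi> (m x y) = m' (\<phi> x) (\<phi> y)))"

definition endo_commutative :: "('k::field^2 \<Rightarrow> 'k^2 \<Rightarrow> 'k^2) \<Rightarrow> bool" where
  "endo_commutative m \<longleftrightarrow> (\<forall>x y. m (m x x) (m y y) = m (m x y) (m x y))"

definition curled :: "('k::field^2 \<Rightarrow> 'k^2 \<Rightarrow> 'k^2) \<Rightarrow> bool" where
  "curled m \<longleftrightarrow> (\<forall>x. \<exists>c. m x x = c *s x)"

abbreviation straight :: "('k::field^2 \<Rightarrow> 'k^2 \<Rightarrow> 'k^2) \<Rightarrow> bool" where
  "straight m \<equiv> \<not> curled m"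

text \<open>The product \<open>m\<close> is that of the algebra \<open>S(p,q,a,b,c,d)\<close> with respect to some linear
  base \<open>{e, f}\<close>, which need not be the standard one.\<close>

definition is_S ::
    "('k::field^2 \<Rightarrow> 'k^2 \<Rightarrow> 'k^2) \<Rightarrow> 'k \<Rightarrow> 'k \<Rightarrow> 'k \<Rightarrow> 'k \<Rightarrow> 'k \<Rightarrow> 'k \<Rightarrow> bool" where
  "is_S m p q a b c d \<longleftrightarrow> algebra_product m \<and>
     (\<exists>e f. e \<noteq> f \<and> vec.independent {e, f} \<and> vec.span {e, f} = UNIV \<and>
        m e e = f \<and>
        m e f = a *s e + b *s f \<and>
        m f e = c *s e + d *s f \<and>
        m f f = p *s e + q *s f)"

definition endo_commutative_type_I :: "('k::field^2 \<Rightarrow> 'k^2 \<Rightarrow> 'k^2) \<Rightarrow> bool" where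
  "endo_commutative_type_I m \<longleftrightarrow> endo_commutative m \<and>
     (\<exists>p q a b c d. is_S m p q a b c d \<and>
        (p \<noteq> 0 \<and> a = 0 \<and> c = 0 \<or> p = 0 \<and> a \<noteq> 0 \<and> c = 0 \<or> p = 0 \<and> a = 0 \<and> c \<noteq> 0))"

definition type_I_iso_rel ::
    "(('k::field^2 \<Rightarrow> 'k^2 \<Rightarrow> 'k^2) \<times> ('k^2 \<Rightarrow> 'k^2 \<Rightarrow> 'k^2)) set" where
  "type_I_iso_rel = {(m, m'). endo_commutative_type_I m \<and> endo_commutative_type_I m' \<and>
     algebra_isomorphic m m'}"

definition type_I_iso_classes :: "('k::field^2 \<Rightarrow> 'k^2 \<Rightarrow> 'k^2) set set" where
  "type_I_iso_classes = {m. endo_commutative_type_I m} // type_I_iso_rel"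

lemma straight_is_S:
  assumes "is_S m p q a b c d"
  shows "straight m"
proof
  assume "curled m"
  from assms obtain e f where ef: "e \<noteq> f" "vec.independent {e, f}" "m e e = f"
    unfolding is_S_def by blast
  from \<open>curled m\<close> obtain k where "f = k *s e"
    using ef(3) unfolding curled_def by metis
  then have "f \<in> vec.span {e}"
    by (simp add: vec.span_base vec.span_scale)
  moreover have "{e, f} - {f} = {e}"
    using ef(1) by auto
  ultimately show False
    using ef(2) unfolding vec.dependent_def by auto
qed

lemma equiv_type_I_iso_rel:
  "equiv {m :: 'k::field^2 \<Rightarrow> 'k^2 \<Rightarrow> 'k^2. endo_commutative_type_I m} type_I_iso_rel"
proof (rule equivI)
  show "type_I_iso_rel \<subseteq> {m :: 'k^2 \<Rightarrow> 'k^2 \<Rightarrow> 'k^2. endo_commutative_type_I m} \<times>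
      {m. endo_commutative_type_I m}"
    by (auto simp: type_I_iso_rel_def)
  have "algebra_isomorphic m m" for m :: "'k^2 \<Rightarrow> 'k^2 \<Rightarrow> 'k^2"
    unfolding algebra_isomorphic_def
    by (rule exI[of _ "\<lambda>x. x"]) (auto simp: vec.linear_ident bij_betw_def)
  then show "refl_on {m :: 'k^2 \<Rightarrow> 'k^2 \<Rightarrow> 'k^2. endo_commutative_type_I m} type_I_iso_rel"
    by (auto simp: refl_on_def type_I_iso_rel_def)
  have "algebra_isomorphic m' m" if iso: "algebra_isomorphic m m'"
    for m m' :: "'k^2 \<Rightarrow> 'k^2 \<Rightarrow> 'k^2"
  proof -
    from iso obtain \<phi> where \<phi>: "Vector_Spaces.linear (*s) (*s) \<phi>" "bij \<phi>"
        "\<And>x y. \<phi> (m x y) = m' (\<phi> x) (\<phi> y)"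
      unfolding algebra_isomorphic_def by blast
    note lin = vec.linear_add[OF \<phi>(1)] vec.linear_scale[OF \<phi>(1)]
    have s: "\<phi> (inv \<phi> x) = x" for x
      by (simp add: \<phi>(2) bij_is_surj surj_f_inv_f)
    have i: "inv \<phi> y = x" if "y = \<phi> x" for x y
      using that \<phi>(2) by (simp add: bij_is_inj)
    have "Vector_Spaces.linear (*s) (*s) (inv \<phi>)"
      by (intro Vector_Spaces.linear_iff[THEN iffD2] conjI allI i)
        (auto simp: lin s vec.vector_space_axioms)
    moreover have "inv \<phi> (m' x y) = m (inv \<phi> x) (inv \<phi> y)" for x y
      by (rule i) (simp add: \<phi>(3) s)
    ultimately show ?thesis
      using bij_imp_bij_inv[OF \<phi>(2)] unfolding algebra_isomorphic_def by blast
  qed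
  then show "sym (type_I_iso_rel :: (('k^2 \<Rightarrow> 'k^2 \<Rightarrow> 'k^2) \<times> _) set)"
    by (auto simp: sym_def type_I_iso_rel_def)
  have "algebra_isomorphic m m''" if iso: "algebra_isomorphic m m'" "algebra_isomorphic m' m''"
    for m m' m'' :: "'k^2 \<Rightarrow> 'k^2 \<Rightarrow> 'k^2"
  proof -
    from iso obtain \<phi> \<psi> where
        "Vector_Spaces.linear (*s) (*s) \<phi>" "bij \<phi>" "\<And>x y. \<phi> (m x y) = m' (\<phi> x) (\<phi> y)"
        "Vector_Spaces.linear (*s) (*s) \<psi>" "bij \<psi>" "\<And>x y. \<psi> (m' x y) = m'' (\<psi> x) (\<psi> y)"
      unfolding algebra_isomorphic_def by metis
    then show ?thesis
      unfolding algebra_isomorphic_def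
      by (intro exI[of _ "\<psi> \<circ> \<phi>"])
        (auto intro: Vector_Spaces.linear_compose bij_comp)
  qed
  then show "trans (type_I_iso_rel :: (('k^2 \<Rightarrow> 'k^2 \<Rightarrow> 'k^2) \<times> _) set)"
    unfolding trans_def type_I_iso_rel_def by blast
qed

end

theory Submission
  imports Defs "HOL-Computational_Algebra.Primes"
begin

text \<open>An algebra of the form \<open>S(p,q,a,b,c,d)\<close> is determined up to isomorphism by its six
  parameters, so over a countable field there are only countably many classes. Conversely
  \<open>S(p,0,0,0,0,0)\<close> is endo-commutative of type I for every \<open>p \<noteq> 0\<close>, and an isomorphism from
  \<open>S(r,0,0,0,0,0)\<close> to \<open>S(p,0,0,0,0,0)\<close> forces \<open>r = p t\<^sup>3\<close> or \<open>r = p\<^sup>2 t\<^sup>3\<close>, which is impossible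
  over \<open>\<rat>\<close> for distinct primes \<open>p\<close> and \<open>r\<close>.\<close>

lemma span_pair_UNIV:
  assumes "vec.span {e, f :: 'k::field^2} = UNIV"
  obtains s t where "x = s *s e + t *s f"
proof -
  have "x \<in> vec.span {e, f}" using assms by simp
  then obtain s t where "x - s *s e = t *s f"
    by (auto simp: vec.span_insert vec.span_singleton)
  then have "x = s *s e + t *s f" by (simp add: algebra_simps)
  then show thesis by (rule that)
qed

lemma algebra_product_add_scale:
  assumes "algebra_product m"
  shows "m (x + y) z = m x z + m y z" "m x (y + z) = m x y + m x z"
    "m (k *s x) z = k *s m x z" "m x (k *s z) = k *s m x z"
  using assms unfolding algebra_product_def
  by (auto dest: vec.linear_add vec.linear_scale)

text \<open>Matching the two bases defines a linear map. It respects products of base vectors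
  because the parameters agree, and all other products by bilinearity.\<close>

lemma algebra_isomorphic_if_is_S:
  fixes m m' :: "'k::field^2 \<Rightarrow> 'k^2 \<Rightarrow> 'k^2"
  assumes "is_S m p q a b c d" "is_S m' p q a b c d"
  shows "algebra_isomorphic m m'"
proof -
  obtain e f where ef: "e \<noteq> f" "vec.independent {e, f}" "vec.span {e, f} = UNIV"
      "m e e = f" "m e f = a *s e + b *s f" "m f e = c *s e + d *s f" "m f f = p *s e + q *s f"
    using assms(1) unfolding is_S_def by blast
  obtain e' f' where ef': "vec.span {e', f'} = UNIV"
      "m' e' e' = f'" "m' e' f' = a *s e' + b *s f'" "m' f' e' = c *s e' + d *s f'"
      "m' f' f' = p *s e' + q *s f'"
    using assms(2) unfolding is_S_def by blast
  have m: "algebra_product m" "algebra_product m'"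
    using assms by (auto simp: is_S_def)
  obtain \<phi> where lin: "Vector_Spaces.linear (*s) (*s) \<phi>"
      and ext: "\<forall>x\<in>{e, f}. \<phi> x = (if x = e then e' else f')"
    using vec.linear_independent_extend[OF ef(2), of "\<lambda>x. if x = e then e' else f'"] by blast
  have img: "\<phi> e = e'" "\<phi> f = f'" using ext ef(1) by auto
  note hom = vec.linear_add[OF lin] vec.linear_scale[OF lin] img
  have "surj \<phi>"
  proof (rule surjI)
    fix y
    obtain s t where "y = s *s e' + t *s f'" using ef'(1) by (rule span_pair_UNIV)
    then have "\<exists>x. \<phi> x = y" by (metis hom)
    then show "\<phi> (SOME x. \<phi> x = y) = y" by (rule someI_ex)
  qed
  \<comment> \<open>In finite dimension a surjective linear endomorphism is injective.\<close>
  then have "bij \<phi>"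
    using vec.linear_surjective_imp_injective[OF lin] by (simp add: bij_def)
  moreover have "\<phi> (m x y) = m' (\<phi> x) (\<phi> y)" for x y
  proof -
    obtain s t where x: "x = s *s e + t *s f" using ef(3) by (rule span_pair_UNIV)
    obtain s' t' where y: "y = s' *s e + t' *s f" using ef(3) by (rule span_pair_UNIV)
    show ?thesis
      by (simp add: x y algebra_product_add_scale[OF m(1)] algebra_product_add_scale[OF m(2)]
          hom ef(4-) ef'(2-))
  qed
  ultimately show ?thesis using lin unfolding algebra_isomorphic_def by blast
qed

lemma countable_type_I_iso_classes:
  "countable (type_I_iso_classes :: ('k::{field,countable}^2 \<Rightarrow> 'k^2 \<Rightarrow> 'k^2) set set)"
proof -
  define S where "S = (\<lambda>(p, q, a, b, c, d) (m :: 'k^2 \<Rightarrow> 'k^2 \<Rightarrow> 'k^2).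
    endo_commutative_type_I m \<and> is_S m p q a b c d)"
  have iso: "(m, m') \<in> type_I_iso_rel" if "S t m" "S t m'" for t m m'
    using that by (auto simp: S_def type_I_iso_rel_def intro: algebra_isomorphic_if_is_S)
  \<comment> \<open>Each class is that of a representative chosen from its parameter tuple alone,
    and the tuples form a countable type. An inclusion suffices, so the arbitrary value of
    \<open>SOME\<close> at tuples that no type I product realises does no harm.\<close>
  have "type_I_iso_classes \<subseteq> range (\<lambda>t. type_I_iso_rel `` {SOME m. S t m})"
  proof
    fix C :: "('k^2 \<Rightarrow> 'k^2 \<Rightarrow> 'k^2) set"
    assume "C \<in> type_I_iso_classes"
    then obtain m where m: "endo_commutative_type_I m" and C: "C = type_I_iso_rel `` {m}"
      by (auto simp: type_I_iso_classes_def elim: quotientE)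
    obtain p q a b c d where "is_S m p q a b c d"
      using m unfolding endo_commutative_type_I_def by blast
    then have "S (p, q, a, b, c, d) m" using m by (simp add: S_def)
    then have "(m, SOME m. S (p, q, a, b, c, d) m) \<in> type_I_iso_rel"
      by (metis iso someI)
    then show "C \<in> range (\<lambda>t. type_I_iso_rel `` {SOME m. S t m})"
      using C equiv_class_eq[OF equiv_type_I_iso_rel] by blast
  qed
  then show ?thesis by (rule countable_subset) simp
qed

text \<open>The algebra \<open>S(p,0,0,0,0,0)\<close> with respect to the standard base.\<close>

definition cubic_product :: "'k::field \<Rightarrow> 'k^2 \<Rightarrow> 'k^2 \<Rightarrow> 'k^2" where
  "cubic_product p x y = vector [p * x $ 2 * y $ 2, x $ 1 * y $ 1]"

lemma cubic_product_nth [simp]: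
  "cubic_product p x y $ 1 = p * x $ 2 * y $ 2" "cubic_product p x y $ 2 = x $ 1 * y $ 1"
  by (simp_all add: cubic_product_def)

lemma is_S_cubic_product: "is_S (cubic_product p) p 0 0 0 0 0"
proof -
  let ?e = "vector [1, 0] :: 'a^2" and ?f = "vector [0, 1] :: 'a^2"
  have ne: "?e \<noteq> ?f" by (simp add: vec_eq_iff forall_2)
  have "vec.independent {?e, ?f}"
    by (auto simp: vec.independent_insert vec.span_singleton vec_eq_iff forall_2)
  moreover have "x \<in> vec.span {?e, ?f}" for x
  proof -
    have "x = x $ 1 *s ?e + x $ 2 *s ?f" by (simp add: vec_eq_iff forall_2)
    then show ?thesis
      by (metis insertCI vec.span_add vec.span_base vec.span_scale)
  qed
  moreover have "algebra_product (cubic_product p)"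
    unfolding algebra_product_def
    by (simp add: Vector_Spaces.linear_iff vec.vector_space_axioms vec_eq_iff forall_2 algebra_simps)
  ultimately show ?thesis
    unfolding is_S_def using ne
    by (intro conjI exI[of _ ?e] exI[of _ ?f]) (auto simp: vec_eq_iff forall_2)
qed

text \<open>Both sides of the endo-commutative law evaluate to
  \<open>(p * x1^2 * y1^2, p^2 * x2^2 * y2^2)\<close>.\<close>

lemma endo_commutative_type_I_cubic_product:
  assumes "p \<noteq> 0"
  shows "endo_commutative_type_I (cubic_product p)"
proof -
  have "endo_commutative (cubic_product p)"
    by (simp add: endo_commutative_def vec_eq_iff forall_2)
  then show ?thesis
    unfolding endo_commutative_type_I_def using is_S_cubic_product assms by blast
qed

text \<open>The relation \<open>ef = 0\<close> forces the image of \<open>e\<close> onto a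
  coordinate axis, and \<open>f^2 = r e\<close> then relates \<open>r\<close> to \<open>p\<close>.
  The two axes give the two alternatives.\<close>

lemma cubic_product_isomorphicD:
  fixes p r :: "'k::field"
  assumes "algebra_isomorphic (cubic_product r) (cubic_product p)" "p \<noteq> 0"
  obtains t where "r = p * t ^ 3" | t where "r = p\<^sup>2 * t ^ 3"
proof -
  let ?e = "vector [1, 0] :: 'k^2" and ?f = "vector [0, 1] :: 'k^2"
  obtain \<phi> where lin: "Vector_Spaces.linear (*s) (*s) \<phi>" and "bij \<phi>"
      and mult: "\<And>x y. \<phi> (cubic_product r x y) = cubic_product p (\<phi> x) (\<phi> y)"
    using assms unfolding algebra_isomorphic_def by blast
  have "cubic_product r ?e ?e = ?f" "cubic_product r ?e ?f = 0" "cubic_product r ?f ?f = r *s ?e"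
    by (simp_all add: vec_eq_iff forall_2)
  then have eqs: "\<phi> ?f = cubic_product p (\<phi> ?e) (\<phi> ?e)" "cubic_product p (\<phi> ?e) (\<phi> ?f) = 0"
      "cubic_product p (\<phi> ?f) (\<phi> ?f) = r *s \<phi> ?e"
    using vec.linear_0[OF lin] vec.linear_scale[OF lin] mult by metis+
  define \<alpha> \<beta> where "\<alpha> = \<phi> ?e $ 1" and "\<beta> = \<phi> ?e $ 2"
  have "?e \<noteq> 0" by (simp add: vec_eq_iff forall_2)
  then have "\<phi> ?e \<noteq> 0"
    using \<open>bij \<phi>\<close> vec.linear_0[OF lin] by (metis bij_pointE)
  then have "\<alpha> \<noteq> 0 \<or> \<beta> \<noteq> 0"
    by (simp add: \<alpha>_def \<beta>_def vec_eq_iff forall_2)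
  \<comment> \<open>Since \<open>\<phi> ?f = (p * \<beta>^2, \<alpha>^2)\<close>, the image of
    \<open>ef = 0\<close> reads
    \<open>(p * \<beta> * \<alpha>^2, p * \<alpha> * \<beta>^2) = 0\<close>.\<close>
  moreover have "\<alpha> = 0 \<or> \<beta> = 0"
    using eqs(2) \<open>p \<noteq> 0\<close> by (auto simp: eqs(1) \<alpha>_def \<beta>_def vec_eq_iff forall_2)
  moreover have "r * \<alpha> = p * \<alpha> ^ 4" "r * \<beta> = p\<^sup>2 * \<beta> ^ 4"
    using eqs(3)
    by (auto simp: eqs(1) \<alpha>_def \<beta>_def vec_eq_iff forall_2 eval_nat_numeral ac_simps)
  \<comment> \<open>Cancel whichever of \<open>\<alpha>\<close>, \<open>\<beta>\<close> is
    nonzero.\<close>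
  ultimately have "r = p * \<alpha> ^ 3 \<or> r = p\<^sup>2 * \<beta> ^ 3"
    by (auto simp: eval_nat_numeral)
  then show thesis using that by blast
qed

text \<open>Compare \<open>r\<close>-adic valuations modulo 3: the left side has valuation 1, while
  the right side has a multiple of 3.\<close>

lemma prime_not_times_rat_cube:
  fixes r n :: int and t :: rat
  assumes "prime r" "\<not> r dvd n"
  shows "of_int r \<noteq> of_int n * t ^ 3"
proof
  assume eq: "of_int r = of_int n * t ^ 3"
  obtain x y where "t = of_int x / of_int y" and "y > 0"
    by (metis Fract_of_int_quotient Rat_cases)
  then have "(of_int (r * y ^ 3) :: rat) = of_int (n * x ^ 3)"
    using eq unfolding \<open>t = _\<close> by (simp add: power_divide field_simps)
  then have xy: "r * y ^ 3 = n * x ^ 3" by (simp only: of_int_eq_iff)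
  \<comment> \<open>Multiplicities add up only over nonzero factors; \<open>n = 0\<close> would be
    divisible by \<open>r\<close>.\<close>
  have "r \<noteq> 0" "x \<noteq> 0" "n \<noteq> 0"
    using xy \<open>y > 0\<close> \<open>prime r\<close> assms(2) by auto
  have r: "prime_elem r" using \<open>prime r\<close> by (rule prime_imp_prime_elem)
  note mult = prime_elem_multiplicity_mult_distrib[OF r] prime_elem_multiplicity_power_distrib[OF r]
  have "multiplicity r (r * y ^ 3) = 1 + 3 * multiplicity r y"
    using \<open>y > 0\<close> \<open>r \<noteq> 0\<close> \<open>prime r\<close> not_prime_unit[of r]
    by (auto simp: mult multiplicity_self)
  moreover have "multiplicity r (n * x ^ 3) = 3 * multiplicity r x"
    using \<open>x \<noteq> 0\<close> \<open>n \<noteq> 0\<close> assms(2) by (simp add: mult not_dvd_imp_multiplicity_0)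
  ultimately have "1 + 3 * multiplicity r y = 3 * multiplicity r x"
    using xy by metis
  then show False by presburger
qed

lemma cubic_product_primes_not_isomorphic:
  fixes p r :: int
  assumes "prime p" "prime r" "p \<noteq> r"
  shows "\<not> algebra_isomorphic (cubic_product (of_int r :: rat)) (cubic_product (of_int p))"
proof
  assume iso: "algebra_isomorphic (cubic_product (of_int r :: rat)) (cubic_product (of_int p))"
  \<comment> \<open>The valuation argument is applied with \<open>n = p\<close> and with
    \<open>n = p^2\<close>, one for each alternative.\<close>
  have "\<not> r dvd p" using assms by (metis primes_dvd_imp_eq)
  moreover from this have "\<not> r dvd p\<^sup>2" using assms(2) by (metis prime_dvd_power)
  moreover have "(of_int p :: rat) \<noteq> 0" using assms(1) by auto
  ultimately show False
    using prime_not_times_rat_cube[OF assms(2)] cubic_product_isomorphicD[OF iso]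
    by (metis of_int_power)
qed

lemma infinite_type_I_iso_classes:
  "infinite (type_I_iso_classes :: (rat^2 \<Rightarrow> rat^2 \<Rightarrow> rat^2) set set)"
proof -
  let ?P = "{p :: nat. prime p}"
  define m where "m = (\<lambda>p :: nat. cubic_product (of_int (int p) :: rat))"
  have m: "endo_commutative_type_I (m p)" if "p \<in> ?P" for p
    using that unfolding m_def by (intro endo_commutative_type_I_cubic_product) auto
  \<comment> \<open>Distinct primes give distinct classes, so the infinitude of primes carries
    over.\<close>
  have "inj_on (\<lambda>p. type_I_iso_rel `` {m p}) ?P"
  proof (rule inj_onI)
    fix p r assume *: "p \<in> ?P" "r \<in> ?P" "type_I_iso_rel `` {m p} = type_I_iso_rel `` {m r}"
    then have "(m r, m p) \<in> type_I_iso_rel"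
      using eq_equiv_class_iff[OF equiv_type_I_iso_rel] m by (metis mem_Collect_eq)
    then have "algebra_isomorphic (m r) (m p)" by (simp add: type_I_iso_rel_def)
    then show "p = r"
      using cubic_product_primes_not_isomorphic[of "int p" "int r"] * by (auto simp: m_def)
  qed
  then have "infinite ((\<lambda>p. type_I_iso_rel `` {m p}) ` ?P)"
    using primes_infinite finite_imageD by blast
  moreover have "(\<lambda>p. type_I_iso_rel `` {m p}) ` ?P \<subseteq> type_I_iso_classes"
    using m by (auto simp: type_I_iso_classes_def intro: quotientI)
  ultimately show ?thesis using finite_subset by blast
qed

theorem corollary4:
  "countable (type_I_iso_classes :: (rat^2 \<Rightarrow> rat^2 \<Rightarrow> rat^2) set set) \<and>
   infinite (type_I_iso_classes :: (rat^2 \<Rightarrow> rat^2 \<Rightarrow> rat^2) set set)"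
  using countable_type_I_iso_classes infinite_type_I_iso_classes by blast

end
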